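(* Let $a>0$, $b>0$, $c\in(0,1)$, let $X=(X_t)_{t\ge0}$ be the tempered stable subordinator with parameters $(a,b;c)$, let $\tilde X_t=\frac1t\int_0^t X_s\,\mathrm{d}s$ for $t>0$, $\tilde X_0=0$, and let $M_{\tilde X_t}(n)=\mathbb{E}\tilde X_t^{\,n}$ for $n\in\{0,1,2,\dots\}$. Then for every $t\ge0$, $M_{\tilde X_t}(0)=1$ and, for every integer $n\ge1$, $$M_{\tilde X_t}(n)=at\sum_{k=0}^{n-1}\binom{n-1}{k}\frac{\Gamma(k-c+1)}{(k+2)\,b^{k-c+1}}\,M_{\tilde X_t}(n-1-k).$$
   Context: For $a>0$, $b>0$, $c\in(0,1)$, the tempered stable subordinator with parameters $(a,b;c)$ is the (càdlàg, nondecreasing) Lévy process $X=(X_t)_{t\ge0}$, $X_0=0$ a.s., with marginal Laplace transform $\mathbb{E}e^{-uX_t}=\exp\left(at\,\Gamma(-c)\left((b+u)^c-b^c\right)\right)$ for $\mathrm{Re}\,u>-b$ (principal branches). $\Gamma(\cdot)$ is the gamma function. *)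

theory Defs
  imports "HOL-Probability.Probability"
begin

definition cadlag :: "(real \<Rightarrow> 'b::topological_space) \<Rightarrow> bool" where
  "cadlag f \<longleftrightarrow>
    (\<forall>t\<ge>0. (f \<longlongrightarrow> f t) (at_right t)) \<and> (\<forall>t>0. \<exists>l. (f \<longlongrightarrow> l) (at_left t))"

text \<open>Time is of type \<^typ>\<open>real\<close>; only the values \<open>X t\<close> with \<open>t \<ge> 0\<close> are constrained or used.
  The path property is required of every sample path, not just almost every one: on a measure
  space that is not complete, time integrals of the process could otherwise fail to be
  measurable.\<close>

locale levy_process = prob_space M for M :: "'a measure" +
  fixes X :: "real \<Rightarrow> 'a \<Rightarrow> real"
  assumes random_variable_X: "\<And>t. t \<ge> 0 \<Longrightarrow> random_variable borel (X t)"
    and X_0: "AE \<omega> in M. X 0 \<omega> = 0"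
    and indep_increments: "\<And>n \<tau>. \<tau> 0 \<ge> 0 \<Longrightarrow> (\<And>i. i < n \<Longrightarrow> \<tau> i < \<tau> (Suc i)) \<Longrightarrow>
      indep_vars (\<lambda>_. borel) (\<lambda>i \<omega>. X (\<tau> (Suc i)) \<omega> - X (\<tau> i) \<omega>) {..<n::nat}"
    and stationary_increments: "\<And>s h. s \<ge> 0 \<Longrightarrow> h \<ge> 0 \<Longrightarrow>
      distr M borel (\<lambda>\<omega>. X (s + h) \<omega> - X s \<omega>) = distr M borel (X h)"
    and stochastically_continuous: "\<And>t \<epsilon>. t \<ge> 0 \<Longrightarrow> \<epsilon> > 0 \<Longrightarrow>
      ((\<lambda>s. prob {\<omega> \<in> space M. \<bar>X s \<omega> - X t \<omega>\<bar> > \<epsilon>}) \<longlongrightarrow> 0) (at t within {0..})"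
    and cadlag_paths: "\<And>\<omega>. \<omega> \<in> space M \<Longrightarrow> cadlag (\<lambda>t. X t \<omega>)"

locale tempered_stable_subordinator = levy_process M X
  for M :: "'a measure" and X :: "real \<Rightarrow> 'a \<Rightarrow> real" +
  fixes a b c :: real
  assumes a_pos: "a > 0" and b_pos: "b > 0" and c_bounds: "c \<in> {0<..<1}"
    and mono_paths: "\<And>\<omega>. \<omega> \<in> space M \<Longrightarrow> mono_on {0..} (\<lambda>t. X t \<omega>)"
    and laplace_transform: "\<And>t (u::complex). t \<ge> 0 \<Longrightarrow> Re u > - b \<Longrightarrow>
      has_bochner_integral M (\<lambda>\<omega>. exp (- u * of_real (X t \<omega>)))
        (exp (of_real (a * t * Gamma (- c)) *
          ((of_real b + u) powr of_real c - of_real b powr of_real c)))"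

definition running_average :: "(real \<Rightarrow> 'a \<Rightarrow> real) \<Rightarrow> real \<Rightarrow> 'a \<Rightarrow> real" where
  "running_average X t \<omega> = (if t = 0 then 0 else 1 / t * (LINT s:{0..t}|lborel. X s \<omega>))"

definition raw_moment :: "'a measure \<Rightarrow> ('a \<Rightarrow> real) \<Rightarrow> nat \<Rightarrow> real" where
  "raw_moment M Y n = (LINT \<omega>|M. Y \<omega> ^ n)"

end

theory Submission
  imports Defs "HOL-Complex_Analysis.Laurent_Convergence" "HOL-Real_Asymp.Real_Asymp"
begin

text \<open>
  Since paths are monotone, \<open>running_average X t - X 0\<close> is the pointwise limit of the Riemann
  means \<open>Y\<^sub>m = (\<Sum>i=1..m. X (i t / m) - X 0) / m\<close>, which satisfy \<open>0 \<le> Y\<^sub>m \<le> X t - X 0\<close>; this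
  bound has an exponential moment, so all moments of \<open>Y\<^sub>m\<close> converge to those of the running
  average. Summation by parts writes \<open>Y\<^sub>m\<close> as a combination of the \<open>m\<close> independent increments
  with weights \<open>w\<^sub>j = (m - j) / m\<close>, so its moment generating function is \<open>exp K\<^sub>m\<close> with an
  explicit \<open>K\<^sub>m\<close>. Comparing power series coefficients in \<open>(exp K\<^sub>m)' = exp K\<^sub>m \<cdot> K\<^sub>m'\<close> gives the
  recurrence for \<open>Y\<^sub>m\<close> with \<open>(\<Sum>j<m. w\<^sub>j ^ (k + 1)) / m\<close> in place of \<open>1 / (k + 2)\<close>, its limit as
  \<open>m\<close> tends to infinity.
\<close>

section \<open>Riemann sums of monotone functions\<close>

lemma riemann_sum_mono_bounds:
  fixes f :: "real \<Rightarrow> real"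
  assumes "mono_on {0..real m * h} f" "h \<ge> 0"
  shows "h * (\<Sum>i<m. f (real i * h)) \<le> integral {0..real m * h} f"
    and "integral {0..real m * h} f \<le> h * (\<Sum>i<m. f (real (Suc i) * h))"
proof -
  have "h * (\<Sum>i<m. f (real i * h)) \<le> integral {0..real m * h} f \<and>
        integral {0..real m * h} f \<le> h * (\<Sum>i<m. f (real (Suc i) * h))"
    using assms(1)
  proof (induction m)
    case 0
    then show ?case by simp
  next
    case (Suc m)
    let ?p = "real m * h" and ?q = "real (Suc m) * h"
    have pq: "0 \<le> ?p" "?p \<le> ?q" using \<open>h \<ge> 0\<close> by (auto intro: mult_right_mono)
    have int: "f integrable_on {0..?q}"
      using Suc.prems by (rule integrable_on_mono_on)
    have int': "f integrable_on {?p..?q}"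
      by (rule integrable_on_subinterval[OF int]) (use pq in auto)
    have split: "integral {0..?q} f = integral {0..?p} f + integral {?p..?q} f"
      using Henstock_Kurzweil_Integration.integral_combine[OF pq int] by simp
    have mono: "f ?p \<le> f x" "f x \<le> f ?q" if "x \<in> {?p..?q}" for x
      using that pq Suc.prems by (auto intro!: mono_onD[OF Suc.prems])
    have len: "?q - ?p = h" by (simp add: algebra_simps)
    have "integral {?p..?q} (\<lambda>_. f ?p) \<le> integral {?p..?q} f"
      using int' mono by (intro integral_le) auto
    then have lo: "h * f ?p \<le> integral {?p..?q} f"
      using pq len by simp
    have "integral {?p..?q} f \<le> integral {?p..?q} (\<lambda>_. f ?q)"
      using int' mono by (intro integral_le) auto
    then have hi: "integral {?p..?q} f \<le> h * f ?q"
      using pq len by simp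
    have "mono_on {0..?p} f"
      by (rule mono_on_subset[OF Suc.prems]) (use pq in auto)
    from Suc.IH[OF this] lo hi show ?case
      unfolding split by (simp add: distrib_left)
  qed
  then show "h * (\<Sum>i<m. f (real i * h)) \<le> integral {0..real m * h} f"
    and "integral {0..real m * h} f \<le> h * (\<Sum>i<m. f (real (Suc i) * h))" by auto
qed

text \<open>Left and right sums enclose the integral, and by telescoping they differ by only
  \<open>t * (f t - f 0) / m\<close>. So monotonicity yields convergence whatever jumps
  \<open>f\<close> has.\<close>

lemma riemann_sum_mono_tendsto:
  fixes f :: "real \<Rightarrow> real"
  assumes "mono_on {0..t} f" "t \<ge> 0"
  shows "(\<lambda>m. t / real m * (\<Sum>i<m. f (real (Suc i) * (t / real m)))) \<longlonglongrightarrow> integral {0..t} f"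
proof (rule tendsto_sandwich)
  have bounds: "integral {0..t} f \<le> t / real m * (\<Sum>i<m. f (real (Suc i) * (t / real m)))"
    "t / real m * (\<Sum>i<m. f (real (Suc i) * (t / real m)))
      \<le> integral {0..t} f + t * (f t - f 0) / real m" if "m > 0" for m
  proof -
    have eq: "real m * (t / real m) = t" using that by simp
    have "mono_on {0..real m * (t / real m)} f" "0 \<le> t / real m" using assms eq by auto
    note * = riemann_sum_mono_bounds[OF this, unfolded eq]
    show "integral {0..t} f \<le> t / real m * (\<Sum>i<m. f (real (Suc i) * (t / real m)))"
      by (rule *)
    have "(\<Sum>i<m. f (real (Suc i) * (t / real m))) - (\<Sum>i<m. f (real i * (t / real m)))
        = f t - f 0"
      using sum_lessThan_telescope[of "\<lambda>i. f (real i * (t / real m))" m] eq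
      by (simp add: sum_subtractf)
    then have "(\<Sum>i<m. f (real (Suc i) * (t / real m)))
        = (\<Sum>i<m. f (real i * (t / real m))) + (f t - f 0)"
      by linarith
    then show "t / real m * (\<Sum>i<m. f (real (Suc i) * (t / real m)))
      \<le> integral {0..t} f + t * (f t - f 0) / real m"
      using *(1) by (simp add: distrib_left)
  qed
  show "\<forall>\<^sub>F m in sequentially. integral {0..t} f
      \<le> t / real m * (\<Sum>i<m. f (real (Suc i) * (t / real m)))"
    using eventually_gt_at_top[of 0] by eventually_elim (rule bounds)
  show "\<forall>\<^sub>F m in sequentially. t / real m * (\<Sum>i<m. f (real (Suc i) * (t / real m)))
      \<le> integral {0..t} f + t * (f t - f 0) / real m"
    using eventually_gt_at_top[of 0] by eventually_elim (rule bounds)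
  have "(\<lambda>m. t * (f t - f 0) / real m) \<longlonglongrightarrow> 0" by real_asymp
  from tendsto_add[OF tendsto_const this]
  show "(\<lambda>m. integral {0..t} f + t * (f t - f 0) / real m) \<longlonglongrightarrow> integral {0..t} f"
    by simp
qed simp

text \<open>\<open>integrable_mono_on\<close> gives integrability for the completed measure
  \<open>lebesgue\<close>; Borel measurability brings it down to \<open>lborel\<close>, over which
  \<open>running_average\<close> integrates.\<close>

lemma set_integrable_mono_on:
  fixes f :: "real \<Rightarrow> real"
  assumes "mono_on {a..b} f"
  shows "set_integrable lborel {a..b} f"
proof -
  have "(\<lambda>x. indicator {a..b} x *\<^sub>R f x) \<in> borel_measurable borel"
    using borel_measurable_mono_on_fnc[OF assms]
    by (subst (asm) borel_measurable_restrict_space_iff) auto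
  moreover have "integrable lebesgue (\<lambda>x. indicator {a..b} x *\<^sub>R f x)"
    using integrable_mono_on[OF assms] by (subst (asm) integrable_restrict_space) auto
  ultimately show ?thesis
    unfolding set_integrable_def by (subst (asm) integrable_completion) auto
qed

text \<open>Read backwards (\<open>i = m - Suc j\<close>), the mean is the right-endpoint Riemann
  sum of \<open>x ^ p\<close> on the unit interval. With \<open>p = k + 1\<close> its limit is the
  factor \<open>1 / (k + 2)\<close> of the recurrence.\<close>

lemma mean_powers_tendsto:
  "(\<lambda>m. (\<Sum>j<m. (real (m - j) / real m) ^ p) / real m) \<longlonglongrightarrow> 1 / (real p + 1)"
proof -
  have mono: "mono_on {0..1} (\<lambda>x::real. x ^ p)"
    by (auto intro!: mono_onI power_mono)
  have "((\<lambda>x::real. x ^ p) has_integral (1 ^ Suc p / Suc p - 0 ^ Suc p / Suc p)) {0..1}"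
  proof (rule fundamental_theorem_of_calculus)
    fix x :: real
    have "((\<lambda>x. x ^ Suc p / Suc p) has_real_derivative x ^ p) (at x within {0..1})"
      by (rule derivative_eq_intros refl | simp del: power_Suc of_nat_Suc)+
    then show "((\<lambda>x. x ^ Suc p / Suc p) has_vector_derivative x ^ p) (at x within {0..1})"
      by (simp only: has_real_derivative_iff_has_vector_derivative)
  qed simp
  then have I: "integral {0..1} (\<lambda>x::real. x ^ p) = 1 / (real p + 1)"
    by (simp add: integral_unique add.commute)
  have "(\<Sum>j<m. (real (m - j) / real m) ^ p) = (\<Sum>i<m. (real (Suc i) / real m) ^ p)" for m
    by (rule sum.reindex_bij_witness[where i="\<lambda>i. m - Suc i" and j="\<lambda>j. m - Suc j"])
      (auto simp: Suc_diff_Suc)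
  with riemann_sum_mono_tendsto[OF mono] I show ?thesis by simp
qed

section \<open>Moments and power series of moment generating functions\<close>

text \<open>For nonnegative \<open>y\<close>, the single term \<open>y ^ n / fact n\<close> of the
  exponential series is at most \<open>exp y\<close>; this is applied to
  \<open>y = r * Z x\<close>.\<close>

lemma nonneg_exp_moment_imp_integrable_power:
  fixes Z :: "'a \<Rightarrow> real"
  assumes [measurable]: "Z \<in> borel_measurable M" and nonneg: "AE x in M. Z x \<ge> 0"
    and "r > 0" and exp: "integrable M (\<lambda>x. exp (r * Z x))"
  shows "integrable M (\<lambda>x. Z x ^ n)"
proof (rule Bochner_Integration.integrable_bound)
  show "integrable M (\<lambda>x. fact n / r ^ n * exp (r * Z x))" using exp by simp
  show "AE x in M. norm (Z x ^ n) \<le> norm (fact n / r ^ n * exp (r * Z x))"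
    using nonneg
  proof eventually_elim
    case (elim x)
    have "(r * Z x) ^ n / fact n \<le> (\<Sum>k<Suc n. (r * Z x) ^ k / fact k)"
      using elim \<open>r > 0\<close> by (intro member_le_sum) auto
    also have "\<dots> \<le> (\<Sum>k. (r * Z x) ^ k / fact k)"
      using elim \<open>r > 0\<close> summable_exp[of "r * Z x"]
      by (intro sum_le_suminf) (auto simp: divide_inverse mult.commute)
    also have "\<dots> = exp (r * Z x)"
      by (simp add: exp_def divide_inverse mult.commute)
    finally show ?case using elim \<open>r > 0\<close> by (simp add: field_simps power_mult_distrib)
  qed
qed measurable

text \<open>In the disc \<open>norm v < r\<close> the exponential series can be integrated term by
  term: the norms of its terms sum almost everywhere to \<open>exp (norm v * Z x)\<close>, which is
  at most the integrable \<open>exp (r * Z x)\<close>.\<close>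

lemma mgf_has_fps_expansion:
  fixes Z :: "'a \<Rightarrow> real"
  assumes [measurable]: "Z \<in> borel_measurable M" and nonneg: "AE x in M. Z x \<ge> 0"
    and r: "r > 0" and exp: "integrable M (\<lambda>x. exp (r * Z x))"
  shows "(\<lambda>v::complex. LINT x|M. exp (v * of_real (Z x))) has_fps_expansion
    Abs_fps (\<lambda>n. of_real (raw_moment M Z n / fact n))"
proof (rule has_fps_expansionI)
  have sums: "(\<lambda>n. of_real (raw_moment M Z n / fact n) * v ^ n) sums
      (LINT x|M. exp (v * of_real (Z x)))" if v: "norm v < r" for v :: complex
  proof -
    note int_pow = nonneg_exp_moment_imp_integrable_power[OF assms]
    let ?f = "\<lambda>n x. v ^ n / fact n * of_real (Z x ^ n)"
    have int: "integrable M (?f n)" for n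
      by (intro integrable_mult_right integrable_of_real int_pow)
    have exp_f: "(\<lambda>n. ?f n x) sums exp (v * of_real (Z x))" for x
      using exp_converges[of "v * of_real (Z x)"]
      by (simp add: power_mult_distrib scaleR_conv_of_real divide_inverse mult_ac)
    have norm_f: "norm (?f n x) = (norm v * \<bar>Z x\<bar>) ^ n / fact n" for n x
      by (simp add: norm_mult norm_divide norm_power power_mult_distrib)
    have exp_norm_f: "(\<lambda>n. norm (?f n x)) sums exp (norm v * \<bar>Z x\<bar>)" for x
      using exp_converges[of "norm v * \<bar>Z x\<bar>"]
      unfolding norm_f by (simp add: divide_inverse mult_ac)
    have "(\<lambda>n. LINT x|M. ?f n x) sums (LINT x|M. (\<Sum>n. ?f n x))"
    proof (rule sums_integral[OF int])
      show "AE x in M. summable (\<lambda>n. norm (?f n x))"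
        using exp_norm_f by (auto simp: sums_iff)
      show "summable (\<lambda>n. LINT x|M. norm (?f n x))"
      proof (rule summableI_nonneg_bounded)
        fix N
        have "(\<Sum>n<N. LINT x|M. norm (?f n x)) = (LINT x|M. (\<Sum>n<N. norm (?f n x)))"
          using int by (subst Bochner_Integration.integral_sum) auto
        also have "\<dots> \<le> (LINT x|M. exp (r * Z x))"
        proof (rule integral_mono_AE)
          show "integrable M (\<lambda>x. \<Sum>n<N. norm (?f n x))"
            using int by (intro Bochner_Integration.integrable_sum integrable_norm)
          show "AE x in M. (\<Sum>n<N. norm (?f n x)) \<le> exp (r * Z x)"
            using nonneg
          proof eventually_elim
            case (elim x)
            have "(\<Sum>n<N. norm (?f n x)) \<le> (\<Sum>n. norm (?f n x))"
              using exp_norm_f[of x] by (intro sum_le_suminf) (auto simp: sums_iff)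
            also have "\<dots> = exp (norm v * Z x)"
              using exp_norm_f[of x] elim by (simp add: sums_iff)
            also have "\<dots> \<le> exp (r * Z x)"
              using elim v by (simp add: mult_right_mono)
            finally show ?case .
          qed
        qed fact
        finally show "(\<Sum>n<N. LINT x|M. norm (?f n x)) \<le> (LINT x|M. exp (r * Z x))" .
      qed simp
    qed
    moreover have "(LINT x|M. ?f n x) = of_real (raw_moment M Z n / fact n) * v ^ n" for n
      unfolding raw_moment_def integral_mult_right_zero integral_complex_of_real
      by (simp add: field_simps)
    moreover have "(\<Sum>n. ?f n x) = exp (v * of_real (Z x))" for x
      using exp_f[of x] by (simp only: sums_iff)
    ultimately show ?thesis by (simp only:)
  qed
  have "\<forall>\<^sub>F v in nhds 0. v \<in> ball (0::complex) r"
    using r by (intro eventually_nhds_in_open) auto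
  then show "\<forall>\<^sub>F v::complex in nhds 0. (\<lambda>n. fps_nth (Abs_fps (\<lambda>n. of_real (raw_moment M Z n / fact n))) n * v ^ n)
      sums (LINT x|M. exp (v * of_real (Z x)))"
    by eventually_elim (use sums in simp)
qed

text \<open>\<open>K\<close> is a local cumulant generating function with derivative
  \<open>L\<close>, and \<open>\<kappa> k\<close> is the cumulant of order \<open>k + 1\<close>.
  Asking for \<open>exp (K v)\<close> as the generating function avoids choosing a branch of its
  logarithm.\<close>

lemma raw_moment_recurrence:
  fixes Z :: "'a \<Rightarrow> real" and K L :: "complex \<Rightarrow> complex"
  assumes "Z \<in> borel_measurable M" "AE x in M. Z x \<ge> 0"
    and "r > 0" "integrable M (\<lambda>x. exp (r * Z x))"
    and mgf: "\<forall>\<^sub>F v in nhds 0. (LINT x|M. exp (v * of_real (Z x))) = exp (K v)"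
    and K: "\<forall>\<^sub>F v in nhds 0. (K has_field_derivative L v) (at v)"
    and L: "L has_fps_expansion Abs_fps (\<lambda>k. of_real (\<kappa> k / fact k))"
  shows "raw_moment M Z (Suc n) =
    (\<Sum>k=0..n. real (n choose k) * \<kappa> k * raw_moment M Z (n - k))"
proof -
  define F :: "complex fps" where "F = Abs_fps (\<lambda>n. of_real (raw_moment M Z n / fact n))"
  define C :: "complex fps" where "C = Abs_fps (\<lambda>k. of_real (\<kappa> k / fact k))"
  have "(\<lambda>v. LINT x|M. exp (v * of_real (Z x))) has_fps_expansion F"
    unfolding F_def by (rule mgf_has_fps_expansion) fact+
  then have F: "(\<lambda>v. exp (K v)) has_fps_expansion F"
    using has_fps_expansion_cong[OF mgf refl] by simp
  have deriv: "\<forall>\<^sub>F v in nhds 0. deriv (\<lambda>v. exp (K v)) v = exp (K v) * L v"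
    using K by eventually_elim (auto intro!: DERIV_imp_deriv derivative_eq_intros)
  have "(\<lambda>v. exp (K v) * L v) has_fps_expansion fps_deriv F"
    using has_fps_expansion_deriv[OF F] has_fps_expansion_cong[OF deriv refl] by blast
  moreover have "(\<lambda>v. exp (K v) * L v) has_fps_expansion F * C"
    using F L unfolding C_def by (rule has_fps_expansion_mult)
  ultimately have "fps_deriv F = C * F"
    by (metis fps_expansion_unique_complex mult.commute)
  then have "fps_nth (fps_deriv F) n = fps_nth (C * F) n" by simp
  \<comment> \<open>The factor \<open>n + 1\<close> from differentiation turns
    \<open>fact (Suc n)\<close> into \<open>fact n\<close>; multiplying by \<open>fact n\<close>
    later produces the binomial coefficients.\<close>
  then have "of_real (raw_moment M Z (Suc n) / fact n) =
      (of_real (\<Sum>k=0..n. \<kappa> k / fact k * (raw_moment M Z (n - k) / fact (n - k))) :: complex)"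
    by (simp add: F_def C_def fps_mult_nth field_simps del: of_nat_Suc)
  then have "raw_moment M Z (Suc n) / fact n =
      (\<Sum>k=0..n. \<kappa> k / fact k * (raw_moment M Z (n - k) / fact (n - k)))"
    by (simp only: of_real_eq_iff)
  then have "raw_moment M Z (Suc n) =
      fact n * (\<Sum>k=0..n. \<kappa> k / fact k * (raw_moment M Z (n - k) / fact (n - k)))"
    by (simp add: field_simps)
  also have "\<dots> = (\<Sum>k=0..n. real (n choose k) * \<kappa> k * raw_moment M Z (n - k))"
    unfolding sum_distrib_left by (intro sum.cong) (auto simp: binomial_fact field_simps)
  finally show ?thesis .
qed

text \<open>This is the binomial series once \<open>b\<close> is pulled out of the base. It serves
  with \<open>s = 1 - c\<close> to expand the derivative of the cumulant generating
  function.\<close>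

lemma powr_minus_has_fps_expansion:
  fixes b w s :: real
  assumes "b > 0"
  shows "(\<lambda>v::complex. (of_real b - of_real w * v) powr of_real (- s)) has_fps_expansion
    Abs_fps (\<lambda>k. of_real (w ^ k * pochhammer s k / fact k / b powr (real k + s)))"
proof -
  let ?q = "complex_of_real (- w / b)"
  have "(\<lambda>v. ?q * v) has_fps_expansion fps_const ?q * fps_X"
    by (intro fps_expansion_intros)
  from has_fps_expansion_compose[OF has_fps_expansion_binomial_complex this, of "of_real (- s)"]
  have "(\<lambda>v. (1 + ?q * v) powr of_real (- s)) has_fps_expansion
      fps_compose (fps_binomial (of_real (- s))) (fps_const ?q * fps_X)"
    by (simp add: o_def)
  from has_fps_expansion_cmult_left[OF this, of "of_real (b powr - s)"]
  have *: "(\<lambda>v. of_real (b powr - s) * (1 + ?q * v) powr of_real (- s)) has_fps_expansion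
      fps_const (of_real (b powr - s)) * (fps_compose (fps_binomial (of_real (- s))) (fps_const ?q * fps_X))" .
  have "((\<lambda>v. 1 + ?q * v) \<longlongrightarrow> 1 + ?q * 0) (nhds 0)"
    by (intro tendsto_intros filterlim_ident)
  then have "\<forall>\<^sub>F v in nhds 0. 1 + ?q * v \<in> - {0}"
    by (rule topological_tendstoD) auto
  \<comment> \<open>Pulling \<open>b\<close> out of a principal power is legitimate because
    \<open>b\<close> is a positive real and the other factor is nonzero: \<open>Ln\<close> of the
    product then splits without a jump of the argument.\<close>
  then have ev: "\<forall>\<^sub>F v::complex in nhds 0.
      of_real (b powr - s) * (1 + ?q * v) powr of_real (- s)
      = (of_real b - of_real w * v) powr of_real (- s)"
  proof eventually_elim
    case (elim v)
    have eq: "of_real b - of_real w * v = of_real b * (1 + ?q * v)"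
      using assms by (simp add: field_simps)
    have "of_real (b powr - s) = (of_real b :: complex) powr of_real (- s)"
      using assms by (simp add: powr_of_real flip: of_real_minus)
    then show ?case
      unfolding eq using assms elim
      by (simp add: powr_def Ln_times_of_real Ln_of_real mult_exp_exp distrib_left del: of_real_divide)
  qed
  have "fps_const (of_real (b powr - s)) * (fps_compose (fps_binomial (of_real (- s))) (fps_const ?q * fps_X))
      = Abs_fps (\<lambda>k. of_real (w ^ k * pochhammer s k / fact k / b powr (real k + s)))"
  proof (rule fps_ext)
    fix k
    \<comment> \<open>The sign \<open>(- 1) ^ k\<close> found here cancels the one in
      \<open>(- w / b) ^ k\<close>.\<close>
    have gchoose: "(of_real (- s) :: complex) gchoose k = of_real ((- 1) ^ k * pochhammer s k / fact k)"
      by (simp add: gbinomial_pochhammer pochhammer_of_real)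
    have "b powr - s * ((- w / b) ^ k * ((- 1) ^ k * pochhammer s k / fact k))
        = w ^ k * pochhammer s k / fact k / b powr (real k + s)"
      using assms
      by (simp add: powr_add powr_realpow powr_minus field_simps flip: power_mult_distrib)
    then have "(of_real (b powr - s) * (?q ^ k *
          of_real ((- 1) ^ k * pochhammer s k / fact k)) :: complex)
        = of_real (w ^ k * pochhammer s k / fact k / b powr (real k + s))"
      by (simp only: flip: of_real_mult of_real_power)
    then show "fps_nth (fps_const (of_real (b powr - s)) *
          (fps_compose (fps_binomial (of_real (- s))) (fps_const ?q * fps_X))) k
        = fps_nth (Abs_fps (\<lambda>k. complex_of_real
          (w ^ k * pochhammer s k / fact k / b powr (real k + s)))) k"
      by (simp only: fps_mult_left_const_nth fps_nth_compose_linear fps_binomial_nth gchoose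
          fps_nth_Abs_fps)
  qed
  with * show ?thesis
    using has_fps_expansion_cong[OF ev refl] by simp
qed


section \<open>Riemann means as sums of independent increments\<close>

text \<open>The increment from \<open>x j\<close> to \<open>x (Suc j)\<close> is part of
  \<open>x (Suc i) - x 0\<close> exactly when \<open>j \<le> i\<close>, so it is counted for
  \<open>m - j\<close> of the indices \<open>i < m\<close>.\<close>

lemma sum_diff_eq_weighted_increments:
  fixes x :: "nat \<Rightarrow> real"
  shows "(\<Sum>i<m. x (Suc i) - x 0) = (\<Sum>j<m. real (m - j) * (x (Suc j) - x j))"
proof (induction m)
  case (Suc m)
  have "(\<Sum>j<m. real (Suc m - j) * (x (Suc j) - x j))
      = (\<Sum>j<m. real (m - j) * (x (Suc j) - x j) + (x (Suc j) - x j))"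
    by (intro sum.cong) (auto simp: Suc_diff_le algebra_simps)
  also have "\<dots> = (\<Sum>i<m. x (Suc i) - x 0) + (x m - x 0)"
    by (simp only: sum.distrib Suc.IH sum_lessThan_telescope)
  finally show ?case by simp
qed simp

context tempered_stable_subordinator
begin

text \<open>Subtracting \<open>X 0\<close>, which vanishes only almost surely, leaves increments
  alone and makes the mean nonnegative on every path. For \<open>m = 0\<close> division by zero
  makes it 0.\<close>

definition riemann_mean :: "real \<Rightarrow> nat \<Rightarrow> 'a \<Rightarrow> real" where
  "riemann_mean t m \<omega> = (\<Sum>i<m. X (real (Suc i) * (t / real m)) \<omega> - X 0 \<omega>) / real m"

lemma riemann_mean_eq:
  "riemann_mean t m \<omega> = (\<Sum>j<m. real (m - j) / real m *
    (X (real (Suc j) * (t / real m)) \<omega> - X (real j * (t / real m)) \<omega>))"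
  using sum_diff_eq_weighted_increments[of "\<lambda>i. X (real i * (t / real m)) \<omega>" m]
  by (simp add: riemann_mean_def sum_divide_distrib)

lemma X_mono: "\<omega> \<in> space M \<Longrightarrow> 0 \<le> s \<Longrightarrow> s \<le> u \<Longrightarrow> X s \<omega> \<le> X u \<omega>"
  using mono_paths[of \<omega>] by (rule mono_onD) auto

lemma measurable_riemann_mean:
  assumes "t \<ge> 0"
  shows "riemann_mean t m \<in> borel_measurable M"
  unfolding riemann_mean_def [abs_def] using assms
  by (intro borel_measurable_divide borel_measurable_sum borel_measurable_diff
        random_variable_X borel_measurable_const) auto

lemma riemann_mean_bounds:
  assumes "\<omega> \<in> space M" "t \<ge> 0"
  shows "0 \<le> riemann_mean t m \<omega>" "riemann_mean t m \<omega> \<le> X t \<omega> - X 0 \<omega>"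
proof -
  show "0 \<le> riemann_mean t m \<omega>"
    unfolding riemann_mean_def using assms X_mono
    by (intro divide_nonneg_nonneg sum_nonneg) auto
  show "riemann_mean t m \<omega> \<le> X t \<omega> - X 0 \<omega>"
  proof (cases "m = 0")
    case True
    with assms X_mono[of \<omega> 0 t] show ?thesis by (simp add: riemann_mean_def)
  next
    case False
    have "(\<Sum>i<m. X (real (Suc i) * (t / real m)) \<omega> - X 0 \<omega>) \<le> (\<Sum>i<m. X t \<omega> - X 0 \<omega>)"
    proof (intro sum_mono diff_right_mono X_mono)
      fix i assume "i \<in> {..<m}"
      then have "real (Suc i) * t \<le> real m * t"
        using assms by (intro mult_right_mono) auto
      with False show "real (Suc i) * (t / real m) \<le> t"
        by (simp add: field_simps del: of_nat_Suc)
    qed (use assms in auto)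
    with False show ?thesis by (simp add: riemann_mean_def field_simps)
  qed
qed

text \<open>The point \<open>u = - r\<close> lies in the half-plane of the Laplace transform because
  \<open>r < b\<close>. Taking norms passes to the real exponential, and \<open>X 0\<close> vanishes
  almost surely.\<close>

lemma integrable_exp_increment:
  assumes "t \<ge> 0" "r < b"
  shows "integrable M (\<lambda>\<omega>. exp (r * (X t \<omega> - X 0 \<omega>)))"
proof -
  have "integrable M (\<lambda>\<omega>. exp (- (- complex_of_real r) * of_real (X t \<omega>)))"
    using laplace_transform[of t "- of_real r"] assms by (auto simp: has_bochner_integral_iff)
  then have "integrable M (\<lambda>\<omega>. norm (exp (- (- complex_of_real r) * of_real (X t \<omega>))))"
    by (rule integrable_norm)
  then have "integrable M (\<lambda>\<omega>. exp (r * X t \<omega>))" by simp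
  moreover have "(\<lambda>\<omega>. exp (r * (X t \<omega> - X 0 \<omega>))) \<in> borel_measurable M"
    using random_variable_X[of t] random_variable_X[of 0] assms by measurable
  moreover have "AE \<omega> in M. exp (r * X t \<omega>) = exp (r * (X t \<omega> - X 0 \<omega>))"
    using X_0 by eventually_elim simp
  ultimately show ?thesis by (rule integrable_cong_AE_imp)
qed

text \<open>By stationarity the increment has the law of \<open>X h\<close>, whose Laplace transform
  is taken at \<open>u = - v\<close>.\<close>

lemma has_integral_exp_increment:
  fixes v :: complex
  assumes "s \<ge> 0" "h \<ge> 0" "Re v < b"
  shows "has_bochner_integral M (\<lambda>\<omega>. exp (v * of_real (X (s + h) \<omega> - X s \<omega>)))
    (exp (of_real (a * h * Gamma (- c)) * ((of_real b - v) powr of_real c - of_real b powr of_real c)))"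
proof -
  have [measurable]: "X h \<in> borel_measurable M" "X s \<in> borel_measurable M"
    "X (s + h) \<in> borel_measurable M"
    using assms by (auto intro: random_variable_X)
  let ?g = "\<lambda>x::real. exp (v * of_real x)"
  have [measurable]: "?g \<in> borel_measurable borel" by measurable
  have L: "has_bochner_integral M (\<lambda>\<omega>. ?g (X h \<omega>))
    (exp (of_real (a * h * Gamma (- c)) * ((of_real b - v) powr of_real c - of_real b powr of_real c)))"
    using laplace_transform[of h "- v"] assms by simp
  have "integrable (distr M borel (X h)) ?g"
    using L by (subst integrable_distr_eq) (auto simp: has_bochner_integral_iff)
  then have "integrable M (\<lambda>\<omega>. ?g (X (s + h) \<omega> - X s \<omega>))"
    unfolding stationary_increments[OF assms(1,2), symmetric]
    by (subst (asm) integrable_distr_eq) auto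
  moreover have "(LINT \<omega>|M. ?g (X (s + h) \<omega> - X s \<omega>)) = (LINT x|distr M borel (X h). ?g x)"
    unfolding stationary_increments[OF assms(1,2), symmetric] by (subst integral_distr) auto
  moreover have "\<dots> = (LINT \<omega>|M. ?g (X h \<omega>))"
    by (subst integral_distr) auto
  ultimately show ?thesis using L by (simp add: has_bochner_integral_iff)
qed

text \<open>By independence the expectation factors over the weighted increments, and each factor is
  the transform of one increment at \<open>v * w j\<close>.\<close>

lemma mgf_riemann_mean:
  fixes v :: complex
  assumes "t > 0" "m > 0" "norm v < b"
  shows "(LINT \<omega>|M. exp (v * of_real (riemann_mean t m \<omega>))) =
    exp (\<Sum>j<m. of_real (a * (t / real m) * Gamma (- c)) *
      ((of_real b - of_real (real (m - j) / real m) * v) powr of_real c - of_real b powr of_real c))"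
proof -
  define \<tau> where "\<tau> i = real i * (t / real m)" for i
  define w where "w j = real (m - j) / real m" for j
  have w: "0 \<le> w j" "w j \<le> 1" for j using assms by (auto simp: w_def divide_le_eq)
  let ?g = "\<lambda>j (x::real). exp (v * of_real (w j) * of_real x)"
  have indep: "indep_vars (\<lambda>_. borel) (\<lambda>j \<omega>. X (\<tau> (Suc j)) \<omega> - X (\<tau> j) \<omega>) {..<m}"
    using assms by (intro indep_increments) (auto simp: \<tau>_def field_simps)
  have indep': "indep_vars (\<lambda>_. borel) (\<lambda>j \<omega>. ?g j (X (\<tau> (Suc j)) \<omega> - X (\<tau> j) \<omega>)) {..<m}"
    by (rule indep_vars_compose2[OF indep]) measurable
  have incr: "has_bochner_integral M (\<lambda>\<omega>. ?g j (X (\<tau> (Suc j)) \<omega> - X (\<tau> j) \<omega>))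
    (exp (of_real (a * (t / real m) * Gamma (- c)) *
      ((of_real b - of_real (w j) * v) powr of_real c - of_real b powr of_real c)))" for j
  proof -
    have "\<tau> (Suc j) = \<tau> j + t / real m" by (simp add: \<tau>_def algebra_simps add_divide_distrib)
    \<comment> \<open>Weights at most 1 keep each argument in the half-plane where the transform is
      available.\<close>
    moreover have "Re (v * of_real (w j)) < b"
    proof -
      have "Re (v * of_real (w j)) \<le> norm (v * of_real (w j))" by (rule complex_Re_le_cmod)
      also have "\<dots> \<le> norm v * 1"
        unfolding norm_mult using w by (intro mult_left_mono) auto
      finally show ?thesis using assms by simp
    qed
    ultimately show ?thesis
      using has_integral_exp_increment[of "\<tau> j" "t / real m" "v * of_real (w j)"] assms
      by (simp add: \<tau>_def mult.commute)
  qed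
  have "(LINT \<omega>|M. exp (v * of_real (riemann_mean t m \<omega>))) =
      (LINT \<omega>|M. (\<Prod>j<m. ?g j (X (\<tau> (Suc j)) \<omega> - X (\<tau> j) \<omega>)))"
    unfolding riemann_mean_eq
    by (simp add: exp_sum[symmetric] sum_distrib_left w_def \<tau>_def mult.assoc)
  also have "\<dots> = (\<Prod>j<m. LINT \<omega>|M. ?g j (X (\<tau> (Suc j)) \<omega> - X (\<tau> j) \<omega>))"
    using incr by (intro indep_vars_lebesgue_integral indep') (auto simp: has_bochner_integral_iff)
  also have "\<dots> = (\<Prod>j<m. exp (of_real (a * (t / real m) * Gamma (- c)) *
      ((of_real b - of_real (w j) * v) powr of_real c - of_real b powr of_real c)))"
    using incr by (intro prod.cong) (auto simp: has_bochner_integral_iff)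
  finally show ?thesis unfolding exp_sum[OF finite_lessThan, symmetric] w_def .
qed

text \<open>In the cumulant of order \<open>k + 1\<close>, one factor \<open>w j\<close> comes from
  the chain rule and \<open>w j ^ k\<close> from the series of the remaining power; the step length
  \<open>t / m\<close> supplies the division by \<open>m\<close>.\<close>

lemma raw_moment_riemann_mean:
  assumes "t > 0" "m > 0"
  shows "raw_moment M (riemann_mean t m) (Suc n) =
    (\<Sum>k=0..n. real (n choose k) *
      (a * t * ((\<Sum>j<m. (real (m - j) / real m) ^ (k + 1)) / real m) *
        (Gamma (real k - c + 1) / b powr (real k - c + 1))) *
      raw_moment M (riemann_mean t m) (n - k))"
proof -
  define w where "w j = real (m - j) / real m" for j
  have w: "0 \<le> w j" "w j \<le> 1" for j using assms by (auto simp: w_def divide_le_eq)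
  define h where "h = t / real m"
  define K :: "complex \<Rightarrow> complex" where "K v = (\<Sum>j<m. of_real (a * h * Gamma (- c)) *
      ((of_real b - of_real (w j) * v) powr of_real c - of_real b powr of_real c))" for v
  \<comment> \<open>This is the derivative of \<open>K\<close>: the chain rule gives
    \<open>- c * w j\<close>, and \<open>- c * Gamma (- c)\<close> is
    \<open>Gamma (1 - c)\<close>.\<close>
  define L :: "complex \<Rightarrow> complex" where "L v = (\<Sum>j<m. of_real (a * h * Gamma (1 - c) * w j) *
      (of_real b - of_real (w j) * v) powr of_real (- (1 - c)))" for v
  have near_0: "\<forall>\<^sub>F v in nhds 0. v \<in> ball (0::complex) b"
    using b_pos by (intro eventually_nhds_in_open) auto
  have Gamma: "Gamma (1 - c) = - c * Gamma (- c)"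
  proof -
    have "- c \<notin> \<int>"
    proof
      assume "- c \<in> \<int>"
      then obtain i where "- c = of_int i" by (elim Ints_cases)
      with c_bounds have "- 1 < real_of_int i" "real_of_int i < 0" by auto
      then have "- 1 < i" "i < 0" by linarith+
      then show False by linarith
    qed
    then have "- c \<notin> \<int>\<^sub>\<le>\<^sub>0" using nonpos_Ints_Int by blast
    then show ?thesis using Gamma_plus1[of "- c"] by simp
  qed
  \<comment> \<open>Any exponent strictly between 0 and \<open>b\<close> would serve for the
    exponential moment.\<close>
  have r: "0 < b / 2" "b / 2 < b" using b_pos by auto
  have "raw_moment M (riemann_mean t m) (Suc n) =
    (\<Sum>k=0..n. real (n choose k) *
      (\<Sum>j<m. a * h * Gamma (1 - c) * w j * (w j ^ k * pochhammer (1 - c) k / b powr (real k + (1 - c)))) *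
      raw_moment M (riemann_mean t m) (n - k))"
  proof (rule raw_moment_recurrence)
    show meas: "riemann_mean t m \<in> borel_measurable M"
      using assms by (intro measurable_riemann_mean) simp
    show "AE \<omega> in M. riemann_mean t m \<omega> \<ge> 0"
      using riemann_mean_bounds assms by auto
    show "0 < b / 2" by fact
    show "integrable M (\<lambda>\<omega>. exp (b / 2 * riemann_mean t m \<omega>))"
    proof (rule Bochner_Integration.integrable_bound)
      show "integrable M (\<lambda>\<omega>. exp (b / 2 * (X t \<omega> - X 0 \<omega>)))"
        using assms r by (intro integrable_exp_increment) auto
      show "(\<lambda>\<omega>. exp (b / 2 * riemann_mean t m \<omega>)) \<in> borel_measurable M"
        using meas by measurable
      show "AE \<omega> in M. norm (exp (b / 2 * riemann_mean t m \<omega>)) \<le> norm (exp (b / 2 * (X t \<omega> - X 0 \<omega>)))"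
        using riemann_mean_bounds assms b_pos by (auto intro!: AE_I2 mult_left_mono)
    qed
    show "\<forall>\<^sub>F v in nhds 0. (LINT \<omega>|M. exp (v * of_real (riemann_mean t m \<omega>))) = exp (K v)"
      using near_0
      by eventually_elim (use assms mgf_riemann_mean in \<open>simp add: K_def w_def h_def\<close>)
    show "\<forall>\<^sub>F v in nhds 0. (K has_field_derivative L v) (at v)"
      using near_0
    proof eventually_elim
      case (elim v)
      have "((\<lambda>v. of_real (a * h * Gamma (- c)) *
          ((of_real b - of_real (w j) * v) powr of_real c - of_real b powr of_real c))
        has_field_derivative of_real (a * h * Gamma (1 - c) * w j) *
          (of_real b - of_real (w j) * v) powr of_real (- (1 - c))) (at v)" for j
      proof -
        have "Re (of_real (w j) * v) \<le> norm (of_real (w j) * v)" by (rule complex_Re_le_cmod)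
        also have "\<dots> \<le> 1 * norm v"
          unfolding norm_mult using w by (intro mult_right_mono) auto
        finally have "Re (of_real b - of_real (w j) * v) > 0" using elim by simp
        \<comment> \<open>Positive real part keeps the base off the branch cut, where the principal
          power is differentiable.\<close>
        then have "of_real b - of_real (w j) * v \<notin> \<real>\<^sub>\<le>\<^sub>0"
          by (auto simp: complex_nonpos_Reals_iff)
        then show ?thesis
          by (auto intro!: derivative_eq_intros simp: Gamma)
      qed
      then show ?case unfolding K_def [abs_def] L_def by (intro DERIV_sum) auto
    qed
    have "L has_fps_expansion (\<Sum>j<m. fps_const (complex_of_real (a * h * Gamma (1 - c) * w j)) *
        Abs_fps (\<lambda>k. of_real (w j ^ k * pochhammer (1 - c) k / fact k / b powr (real k + (1 - c)))))"
      unfolding L_def [abs_def]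
      by (intro has_fps_expansion_sum has_fps_expansion_cmult_left
          powr_minus_has_fps_expansion b_pos)
    also have "(\<Sum>j<m. fps_const (complex_of_real (a * h * Gamma (1 - c) * w j)) *
        Abs_fps (\<lambda>k. of_real (w j ^ k * pochhammer (1 - c) k / fact k / b powr (real k + (1 - c)))))
      = Abs_fps (\<lambda>k. of_real ((\<Sum>j<m. a * h * Gamma (1 - c) * w j *
          (w j ^ k * pochhammer (1 - c) k / b powr (real k + (1 - c)))) / fact k))"
      by (intro fps_ext) (simp add: fps_sum_nth sum_divide_distrib mult_ac)
    finally show "L has_fps_expansion Abs_fps (\<lambda>k. of_real ((\<Sum>j<m. a * h * Gamma (1 - c) * w j *
          (w j ^ k * pochhammer (1 - c) k / b powr (real k + (1 - c)))) / fact k))" .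
  qed
  moreover have "(\<Sum>j<m. a * h * Gamma (1 - c) * w j *
      (w j ^ k * pochhammer (1 - c) k / b powr (real k + (1 - c)))) =
      a * t * ((\<Sum>j<m. w j ^ (k + 1)) / real m) * (Gamma (real k - c + 1) / b powr (real k - c + 1))" for k
  proof -
    \<comment> \<open>The Pochhammer symbol becomes a quotient of Gamma values whose denominator
      cancels the prefactor \<open>Gamma (1 - c)\<close>.\<close>
    have "1 - c \<notin> \<int>\<^sub>\<le>\<^sub>0" using c_bounds by (auto elim!: nonpos_Ints_cases)
    then have "pochhammer (1 - c) k = Gamma (real k - c + 1) / Gamma (1 - c)"
      by (subst pochhammer_Gamma) (auto simp: algebra_simps)
    moreover have "Gamma (1 - c) \<noteq> 0"
      by (rule less_imp_neq[OF Gamma_real_pos, symmetric]) (use c_bounds in auto)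
    ultimately show ?thesis
      by (simp add: h_def sum_distrib_left sum_distrib_right sum_divide_distrib field_simps)
  qed
  ultimately show ?thesis by (simp add: w_def)
qed

section \<open>Passage to the limit\<close>

lemma riemann_mean_tendsto:
  assumes "t > 0" "\<omega> \<in> space M"
  shows "(\<lambda>m. riemann_mean t m \<omega>) \<longlonglongrightarrow> running_average X t \<omega> - X 0 \<omega>"
proof -
  have mono: "mono_on {0..t} (\<lambda>s. X s \<omega>)"
    using mono_paths[OF assms(2)] by (rule mono_on_subset) auto
  have "(LINT s:{0..t}|lborel. X s \<omega>) = integral {0..t} (\<lambda>s. X s \<omega>)"
    by (rule set_borel_integral_eq_integral(2)[OF set_integrable_mono_on[OF mono]])
  then have "(\<lambda>m. 1 / t * (t / real m * (\<Sum>i<m. X (real (Suc i) * (t / real m)) \<omega>)) - X 0 \<omega>)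
      \<longlonglongrightarrow> running_average X t \<omega> - X 0 \<omega>"
    using tendsto_diff[OF tendsto_mult[OF tendsto_const[of "1 / t"]
        riemann_sum_mono_tendsto[OF mono]] tendsto_const[of "X 0 \<omega>"]] assms
    by (simp add: running_average_def)
  moreover have "\<forall>\<^sub>F m in sequentially.
      1 / t * (t / real m * (\<Sum>i<m. X (real (Suc i) * (t / real m)) \<omega>)) - X 0 \<omega> = riemann_mean t m \<omega>"
    using eventually_gt_at_top[of 0]
    by eventually_elim (use assms in \<open>simp add: riemann_mean_def sum_subtractf field_simps\<close>)
  ultimately show ?thesis by (rule Lim_transform_eventually)
qed

text \<open>Dominated convergence applies because \<open>(X t - X 0) ^ n\<close> is integrable and
  bounds the powers of all Riemann means at once.\<close>

lemma
  assumes "t > 0"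
  shows integrable_running_average_power: "integrable M (\<lambda>\<omega>. running_average X t \<omega> ^ n)"
    and raw_moment_riemann_mean_tendsto:
      "(\<lambda>m. raw_moment M (riemann_mean t m) n) \<longlonglongrightarrow> raw_moment M (running_average X t) n"
proof -
  have [measurable]: "X 0 \<in> borel_measurable M" "X t \<in> borel_measurable M"
    "riemann_mean t m \<in> borel_measurable M" for m
    using assms by (auto intro: random_variable_X measurable_riemann_mean)
  \<comment> \<open>The time integral is measurable as a pointwise limit of measurable means; this
    replaces an argument by joint measurability of the process.\<close>
  have "(\<lambda>\<omega>. running_average X t \<omega> - X 0 \<omega>) \<in> borel_measurable M"
    by (rule borel_measurable_LIMSEQ_real[where u="riemann_mean t"])
      (auto intro: riemann_mean_tendsto assms)
  then have "(\<lambda>\<omega>. (running_average X t \<omega> - X 0 \<omega>) + X 0 \<omega>) \<in> borel_measurable M"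
    by measurable
  then have "(\<lambda>\<omega>. running_average X t \<omega>) \<in> borel_measurable M" by simp
  then have 1: "(\<lambda>\<omega>. running_average X t \<omega> ^ n) \<in> borel_measurable M" by measurable
  have 2: "(\<lambda>\<omega>. riemann_mean t m \<omega> ^ n) \<in> borel_measurable M" for m by measurable
  have 3: "integrable M (\<lambda>\<omega>. (X t \<omega> - X 0 \<omega>) ^ n)"
  proof (rule nonneg_exp_moment_imp_integrable_power)
    show "AE \<omega> in M. X t \<omega> - X 0 \<omega> \<ge> 0" using X_mono assms by auto
    show "0 < b / 2" using b_pos by simp
    show "integrable M (\<lambda>\<omega>. exp (b / 2 * (X t \<omega> - X 0 \<omega>)))"
      using assms b_pos by (intro integrable_exp_increment) auto
  qed measurable
  have 4: "AE \<omega> in M. (\<lambda>m. riemann_mean t m \<omega> ^ n) \<longlonglongrightarrow> running_average X t \<omega> ^ n"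
    using X_0 AE_space
  proof eventually_elim
    case (elim \<omega>)
    with riemann_mean_tendsto[OF assms, of \<omega>] show ?case by (auto intro: tendsto_power)
  qed
  have 5: "AE \<omega> in M. norm (riemann_mean t m \<omega> ^ n) \<le> (X t \<omega> - X 0 \<omega>) ^ n" for m
    using riemann_mean_bounds assms by (auto intro!: AE_I2 power_mono simp: norm_power)
  show "integrable M (\<lambda>\<omega>. running_average X t \<omega> ^ n)"
    using 1 2 3 4 5 by (rule integrable_dominated_convergence)
  show "(\<lambda>m. raw_moment M (riemann_mean t m) n) \<longlonglongrightarrow> raw_moment M (running_average X t) n"
    unfolding raw_moment_def using 1 2 3 4 5 by (rule integral_dominated_convergence)
qed

text \<open>For fixed \<open>n\<close> the recurrence of the Riemann means is a finite sum, so it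
  passes to the limit term by term; uniqueness of limits then identifies both sides.\<close>

lemma raw_moment_running_average_Suc:
  assumes "t > 0"
  shows "raw_moment M (running_average X t) (Suc n) =
      a * t * (\<Sum>k=0..n. real (n choose k) *
        (Gamma (real k - c + 1) / ((real k + 2) * b powr (real k - c + 1))) *
        raw_moment M (running_average X t) (n - k))"
proof (rule LIMSEQ_unique[OF raw_moment_riemann_mean_tendsto[OF assms]])
  let ?R = "\<lambda>m. \<Sum>k=0..n. real (n choose k) *
      (a * t * ((\<Sum>j<m. (real (m - j) / real m) ^ (k + 1)) / real m) *
        (Gamma (real k - c + 1) / b powr (real k - c + 1))) *
      raw_moment M (riemann_mean t m) (n - k)"
  have "?R \<longlonglongrightarrow> (\<Sum>k=0..n. real (n choose k) *
      (a * t * (1 / (real (k + 1) + 1)) * (Gamma (real k - c + 1) / b powr (real k - c + 1))) *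
      raw_moment M (running_average X t) (n - k))"
    by (intro tendsto_intros mean_powers_tendsto raw_moment_riemann_mean_tendsto assms)
  moreover have "\<forall>\<^sub>F m in sequentially. ?R m = raw_moment M (riemann_mean t m) (Suc n)"
    using eventually_gt_at_top[of 0]
    by eventually_elim (rule raw_moment_riemann_mean[OF assms, symmetric])
  ultimately have "(\<lambda>m. raw_moment M (riemann_mean t m) (Suc n)) \<longlonglongrightarrow> (\<Sum>k=0..n. real (n choose k) *
      (a * t * (1 / (real (k + 1) + 1)) * (Gamma (real k - c + 1) / b powr (real k - c + 1))) *
      raw_moment M (running_average X t) (n - k))"
    by (rule Lim_transform_eventually)
  then show "(\<lambda>m. raw_moment M (riemann_mean t m) (Suc n)) \<longlonglongrightarrow> a * t * (\<Sum>k=0..n. real (n choose k) *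
        (Gamma (real k - c + 1) / ((real k + 2) * b powr (real k - c + 1))) *
        raw_moment M (running_average X t) (n - k))"
    by (simp add: sum_distrib_left mult_ac add_ac)
qed

end

theorem theorem6:
  fixes M :: "'a measure" and X :: "real \<Rightarrow> 'a \<Rightarrow> real" and a b c t :: real
  assumes "tempered_stable_subordinator M X a b c"
    and "t \<ge> 0"
  shows "(\<forall>n. integrable M (\<lambda>\<omega>. running_average X t \<omega> ^ n)) \<and>
    raw_moment M (running_average X t) 0 = 1 \<and>
    (\<forall>n\<ge>1. raw_moment M (running_average X t) n =
      a * t * (\<Sum>k=0..n-1. real ((n - 1) choose k) *
        (Gamma (real k - c + 1) / ((real k + 2) * b powr (real k - c + 1))) *
        raw_moment M (running_average X t) (n - 1 - k)))"
proof -
  interpret tempered_stable_subordinator M X a b c by fact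
  have "raw_moment M (running_average X t) 0 = 1"
    by (simp add: raw_moment_def prob_space)
  \<comment> \<open>The case \<open>t = 0\<close> is separate here and below: the average is then
    constantly 0, so its powers are integrable, and its positive moments vanish together with the
    factor \<open>a * t\<close>.\<close>
  moreover have "integrable M (\<lambda>\<omega>. running_average X t \<omega> ^ n)" for n
    using integrable_running_average_power[of t n] assms(2)
    by (cases "t = 0") (auto simp: running_average_def)
  moreover have "raw_moment M (running_average X t) (Suc n) =
      a * t * (\<Sum>k=0..n. real (n choose k) *
        (Gamma (real k - c + 1) / ((real k + 2) * b powr (real k - c + 1))) *
        raw_moment M (running_average X t) (n - k))" for n
    using raw_moment_running_average_Suc[of t n] assms(2)
    by (cases "t = 0") (auto simp: running_average_def raw_moment_def)
  ultimately show ?thesis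
    by (auto simp: Suc_le_eq gr0_conv_Suc)
qed

end
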